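(* Let $g(z)=z+\sum_{n\ge 2}g_nz^n\in\mathbb{A}$, write $[n]_g=g_n$, and let $\phi(z)=1+B_1z+B_2z^2+\cdots$ be as in the context. If $f(z)=z+\sum_{n\ge2}a_nz^n\in\mathbb{A}$ belongs to $\mathcal{S}^{\ast}_g(\phi)$, then for every complex number $\mu$, $$|a_3-\mu a_2^2|\le \frac{B_1}{[3]_g-1}\max\left\{1,\left|\frac{B_2}{B_1}+\frac{B_1}{[2]_g-1}\left(1-\frac{[3]_g-1}{[2]_g-1}\mu\right)\right|\right\}.$$
   Context: $\mathbb{U}=\{z\in\mathbb{C}:|z|<1\}$, and $\mathbb{A}$ is the set of analytic functions $f$ on $\mathbb{U}$ with $f(0)=0$, $f'(0)=1$, i.e. $f(z)=z+\sum_{n\ge2}a_nz^n$. For analytic $F,\phi$ on $\mathbb{U}$, $F\prec\phi$ (subordination) means there is an analytic $u$ on $\mathbb{U}$ with $u(0)=0$, $|u(z)|<1$ and $F(z)=\phi(u(z))$ for all $z\in\mathbb{U}$. For $g(z)=z+\sum_{n\ge2}g_nz^n\in\mathbb{A}$, the $g$-derivative of $f\in\mathbb{A}$ is $D_gf(z)=\frac1z\left(z+\sum_{n\ge2}[n]_ga_nz^n\right)$, where $[n]_g=g_n$ (so $zD_gf$ is the convolution, i.e. Hadamard product, of $f$ and $g$). The function $\phi$ is analytic on $\mathbb{U}$ with positive real part, $\phi(0)=1$, $\phi'(0)>0$, $\phi(\mathbb{U})$ symmetric with respect to the real axis, with expansion $\phi(z)=1+B_1z+B_2z^2+B_3z^3+\cdots$,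 $B_1>0$. The class $\mathcal{S}^{\ast}_g(\phi)$ consists of all $f\in\mathbb{A}$ such that $\frac{zD_gf(z)}{f(z)}\prec\phi(z)$.
   Formalization: The factor B_1/([3]_g-1) is replaced by its modulus, since for real [3]_g<1 the stated bound is negative and fails for f(z)=z (e.g. g(z)=z); [2]_g and [3]_g are assumed different from 1 so that the denominators are nonzero. *)

theory Defs
  imports "HOL-Complex_Analysis.Complex_Analysis"
begin

definition normalized_analytic :: "(complex \<Rightarrow> complex) set" where
  "normalized_analytic = {f. f holomorphic_on ball 0 1 \<and> f 0 = 0 \<and> deriv f 0 = 1}"

abbreviation taylor_coeff :: "(complex \<Rightarrow> complex) \<Rightarrow> nat \<Rightarrow> complex" where
  "taylor_coeff f n \<equiv> fps_nth (fps_expansion f 0) n"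

definition subordinate :: "(complex \<Rightarrow> complex) \<Rightarrow> (complex \<Rightarrow> complex) \<Rightarrow> bool"
    (infix "\<prec>" 50) where
  "F \<prec> \<phi> \<longleftrightarrow>
     F holomorphic_on ball 0 1 \<and> \<phi> holomorphic_on ball 0 1 \<and>
     (\<exists>u. u holomorphic_on ball 0 1 \<and> u 0 = 0 \<and>
          (\<forall>z\<in>ball 0 1. cmod (u z) < 1 \<and> F z = \<phi> (u z)))"

definition g_number :: "(complex \<Rightarrow> complex) \<Rightarrow> nat \<Rightarrow> complex" where
  "g_number g n = taylor_coeff g n"

text \<open>
  Writing \<open>[n]\<^sub>g\<close> for \<open>g_number g n\<close>: the series \<open>z + (\<Sum>n\<ge>2. [n]\<^sub>g a\<^sub>n z ^ n)\<close>, divided by \<open>z\<close> term by term, so that the value at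
  \<open>0\<close> is \<open>1\<close>.  The leading coefficient is \<open>[1]\<^sub>g a\<^sub>1 = 1\<close> for normalized \<open>f\<close> and \<open>g\<close>.
\<close>
definition g_derivative :: "(complex \<Rightarrow> complex) \<Rightarrow> (complex \<Rightarrow> complex) \<Rightarrow> complex \<Rightarrow> complex" where
  "g_derivative g f z = (\<Sum>n. g_number g (Suc n) * taylor_coeff f (Suc n) * z ^ n)"

text \<open>
  Symmetry about the real axis is required of the image only; as \<open>\<phi>\<close> need not be injective, its
  coefficients beyond the first are not assumed to be real.
\<close>
definition positive_symmetric :: "(complex \<Rightarrow> complex) \<Rightarrow> bool" where
  "positive_symmetric \<phi> \<longleftrightarrow>
     \<phi> holomorphic_on ball 0 1 \<and> (\<forall>z\<in>ball 0 1. Re (\<phi> z) > 0) \<and> \<phi> 0 = 1 \<and>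
     deriv \<phi> 0 \<in> \<real> \<and> Re (deriv \<phi> 0) > 0 \<and>
     cnj ` (\<phi> ` ball 0 1) = \<phi> ` ball 0 1"

text \<open>
  The quotient is \<open>0 / 0\<close> at the origin; \<open>remove_sings\<close> gives it its limit \<open>1\<close> there, and
  its limit at any other zero of \<open>f\<close> where the singularity is removable.  Poles cannot occur:
  \<open>remove_sings\<close> takes the value \<open>0\<close> at a pole, which a \<open>\<phi>\<close> with positive real part omits.
\<close>
definition g_starlike :: "(complex \<Rightarrow> complex) \<Rightarrow> (complex \<Rightarrow> complex) \<Rightarrow> (complex \<Rightarrow> complex) set" where
  "g_starlike g \<phi> =
     {f \<in> normalized_analytic. remove_sings (\<lambda>z. z * g_derivative g f z / f z) \<prec> \<phi>}"

end

theory Submission imports Defs begin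

text \<open>
  Write \<open>F\<close> for the quotient of \<open>z D\<^sub>g f\<close> by \<open>f\<close>, with \<open>F = \<phi> \<circ> u\<close> for a Schwarz function
  \<open>u = c\<^sub>1 z + c\<^sub>2 z\<^sup>2 + \<dots>\<close>.  Comparing the coefficients of \<open>z\<^sup>2\<close> and \<open>z\<^sup>3\<close> in
  \<open>F \<cdot> f = z D\<^sub>g f\<close> expresses \<open>a\<^sub>2\<close> and \<open>a\<^sub>3\<close> through \<open>c\<^sub>1\<close>, \<open>c\<^sub>2\<close> and the \<open>B\<^sub>n\<close>:
  \<open>([2]\<^sub>g - 1) a\<^sub>2 = B\<^sub>1 c\<^sub>1\<close> and
  \<open>([3]\<^sub>g - 1) a\<^sub>3 = B\<^sub>1 c\<^sub>2 + B\<^sub>2 c\<^sub>1\<^sup>2 + B\<^sub>1 c\<^sub>1 a\<^sub>2\<close>.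
  Hence \<open>a\<^sub>3 - \<mu> a\<^sub>2\<^sup>2\<close> is \<open>B\<^sub>1 / ([3]\<^sub>g - 1)\<close> times \<open>c\<^sub>2 + t c\<^sub>1\<^sup>2\<close>, where \<open>t\<close> is the number
  whose modulus occurs in the maximum, and everything rests on the inequality
  \<open>\<bar>c\<^sub>2 + t c\<^sub>1\<^sup>2\<bar> \<le> max 1 \<bar>t\<bar>\<close> of Keogh and Merkes (\<open>Schwarz_Fekete_Szego\<close>).

  That inequality follows from \<open>\<bar>c\<^sub>2\<bar> \<le> 1 - \<bar>c\<^sub>1\<bar>\<^sup>2\<close> (\<open>Schwarz_second_coeff\<close>), which is the
  Schwarz--Pick inequality at the origin for \<open>u(z) / z\<close>.

  All coefficient comparisons are made between formal power series.  This requires that the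
  Hadamard product defining \<open>D\<^sub>g f\<close> converges near the origin
  (\<open>g_derivative_has_fps_expansion\<close>) and that clearing the denominator in \<open>F\<close> is legitimate
  there although the quotient is \<open>0 / 0\<close> at the origin itself (\<open>g_quotient_mult_eq\<close>).
\<close>

section \<open>Taylor coefficients on the unit disc\<close>

lemma taylor_coeff_1: "taylor_coeff f 1 = deriv f 0"
  by (simp add: fps_expansion_def)

lemma normalized_analytic_taylor_coeff:
  assumes "f \<in> normalized_analytic"
  shows "taylor_coeff f 0 = 0" "taylor_coeff f 1 = 1"
  using assms by (auto simp: normalized_analytic_def fps_expansion_def)

lemma has_fps_expansion_unit_disc:
  assumes "f holomorphic_on ball 0 1"
  shows "f has_fps_expansion fps_expansion f 0"
  using assms by (intro has_fps_expansion_fps_expansion[of "ball 0 1"]) auto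

lemma fps_expansion_eq_unit_disc:
  assumes "\<And>z. cmod z < 1 \<Longrightarrow> f z = h z" and "h has_fps_expansion H"
  shows "fps_expansion f 0 = H"
proof (rule fps_expansion_eqI)
  have "eventually (\<lambda>z. z \<in> ball 0 1) (nhds (0::complex))"
    by (intro eventually_nhds_in_open) auto
  then have "eventually (\<lambda>z. f z = h z) (nhds 0)"
    by eventually_elim (simp add: assms(1))
  then show "f has_fps_expansion H"
    using assms(2) by (subst has_fps_expansion_cong) auto
qed

section \<open>Coefficient inequalities for Schwarz functions\<close>

text \<open>
  Schwarz--Pick at the origin: composing \<open>v\<close> with the disc automorphism that sends \<open>v 0\<close> to \<open>0\<close>
  reduces the claim to Schwarz's lemma, and that automorphism has derivative
  \<open>1 / (1 - \<bar>v 0\<bar>\<^sup>2)\<close> at \<open>v 0\<close>.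
\<close>
lemma Schwarz_Pick_deriv_0:
  assumes hol: "v holomorphic_on ball 0 1"
    and less: "\<And>z. cmod z < 1 \<Longrightarrow> cmod (v z) < 1"
  shows "cmod (deriv v 0) \<le> 1 - (cmod (v 0))\<^sup>2"
proof -
  define c where "c = v 0"
  define w where "w = Moebius_function 0 c \<circ> v"
  have c: "cmod c < 1" using less[of 0] by (simp add: c_def)
  have "w holomorphic_on ball 0 1"
    unfolding w_def
    using less by (intro holomorphic_on_compose_gen[OF hol Moebius_function_holomorphic[OF c]]) auto
  moreover have "w 0 = 0" by (simp add: w_def c_def Moebius_function_def)
  moreover have "cmod (w z) < 1" if "cmod z < 1" for z
    using Moebius_function_norm_lt_1[OF c less[OF that]] by (simp add: w_def)
  ultimately have 1: "cmod (deriv w 0) \<le> 1"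
    by (rule Schwarz_Lemma(2)[where \<xi> = 0]) auto
  have sq: "1 - cnj c * c = of_real (1 - (cmod c)\<^sup>2)"
    by (simp only: of_real_diff of_real_1 complex_norm_square mult.commute)
  have pos: "1 - (cmod c)\<^sup>2 > 0"
    using c by (simp add: power_less_one_iff abs_square_less_1)
  have nz: "1 - cnj c * v 0 \<noteq> 0"
    using pos sq unfolding c_def by (metis of_real_eq_0_iff less_irrefl)
  have v: "(v has_field_derivative deriv v 0) (at 0)"
    using hol by (rule holomorphic_derivI) auto
  have "((\<lambda>z. (v z - c) / (1 - cnj c * v z)) has_field_derivative
      (deriv v 0 * (1 - cnj c * v 0) - (v 0 - c) * (- (cnj c * deriv v 0))) /
        ((1 - cnj c * v 0) * (1 - cnj c * v 0))) (at 0)"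
    using nz by (auto intro!: derivative_eq_intros v)
  moreover have "w = (\<lambda>z. (v z - c) / (1 - cnj c * v z))"
    by (auto simp: w_def Moebius_function_def)
  ultimately have "deriv w 0 = deriv v 0 / (1 - cnj c * c)"
    using nz by (auto intro!: DERIV_imp_deriv simp: c_def)
  then have "cmod (deriv w 0) = cmod (deriv v 0) / (1 - (cmod c)\<^sup>2)"
    using pos by (simp only: sq norm_divide norm_of_real abs_of_pos)
  with 1 pos show ?thesis by (simp add: c_def field_simps)
qed

text \<open>
  Schwarz--Pick applies to \<open>v(z) = u(z) / z\<close>, whose value and derivative at the origin are the
  first two coefficients of \<open>u\<close>, provided that \<open>v\<close> maps the disc into the open disc.  By the
  equality case of Schwarz's lemma this fails only for rotations, whose second coefficient is \<open>0\<close>.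
\<close>
lemma Schwarz_second_coeff:
  assumes hol: "u holomorphic_on ball 0 1" and u0: "u 0 = 0"
    and less: "\<And>z. cmod z < 1 \<Longrightarrow> cmod (u z) < 1"
  shows "cmod (taylor_coeff u 2) \<le> 1 - (cmod (taylor_coeff u 1))\<^sup>2"
proof -
  obtain v where v: "v holomorphic_on ball 0 1" and uv: "\<And>z. cmod z < 1 \<Longrightarrow> u z = z * v z"
    and v0: "deriv u 0 = v 0"
    using Schwarz3[OF hol u0] by blast
  have "(\<lambda>z. z * v z) has_fps_expansion fps_X * fps_expansion v 0"
    by (intro fps_expansion_intros has_fps_expansion_unit_disc v)
  with uv have "fps_expansion u 0 = fps_X * fps_expansion v 0"
    by (rule fps_expansion_eq_unit_disc)
  then have c2: "taylor_coeff u 2 = deriv v 0"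
    by (simp add: taylor_coeff_1[simplified])
  show ?thesis
  proof (cases "(\<exists>z. cmod z < 1 \<and> z \<noteq> 0 \<and> cmod (u z) = cmod z) \<or> cmod (deriv u 0) = 1")
    case True
    then obtain \<alpha> where \<alpha>: "\<And>z. cmod z < 1 \<Longrightarrow> u z = \<alpha> * z" "cmod \<alpha> = 1"
      using Schwarz_Lemma(3)[OF hol u0 less, of 0] by auto
    have "(\<lambda>z. \<alpha> * z) has_fps_expansion fps_const \<alpha> * fps_X"
      by (intro fps_expansion_intros)
    with \<alpha>(1) have "fps_expansion u 0 = fps_const \<alpha> * fps_X"
      by (rule fps_expansion_eq_unit_disc)
    then show ?thesis using \<alpha>(2) by simp
  next
    case False
    have "cmod (v z) < 1" if z: "cmod z < 1" for z
    proof (cases "z = 0")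
      case True
      have "cmod (deriv u 0) \<le> 1"
        using Schwarz_Lemma(2)[OF hol u0 less, of 0] by auto
      with False True show ?thesis by (simp add: v0)
    next
      case nz: False
      have "cmod (u z) < cmod z"
        using Schwarz_Lemma(1)[OF hol u0 less z] False z nz by fastforce
      with nz show ?thesis by (simp add: uv[OF z] norm_mult)
    qed
    from Schwarz_Pick_deriv_0[OF v this] show ?thesis
      unfolding c2 taylor_coeff_1 v0 .
  qed
qed

text \<open>
  By the preceding bound the left-hand side is at most a convex combination of \<open>1\<close> and \<open>\<bar>t\<bar>\<close>,
  with weight \<open>\<bar>c\<^sub>1\<bar>\<^sup>2\<close> on \<open>\<bar>t\<bar>\<close>.
\<close>
lemma Schwarz_Fekete_Szego:
  assumes "u holomorphic_on ball 0 1" "u 0 = 0"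
    and "\<And>z. cmod z < 1 \<Longrightarrow> cmod (u z) < 1"
  shows "cmod (taylor_coeff u 2 + t * (taylor_coeff u 1)\<^sup>2) \<le> max 1 (cmod t)"
proof -
  define c where "c = (cmod (taylor_coeff u 1))\<^sup>2"
  have c2: "cmod (taylor_coeff u 2) \<le> 1 - c"
    using Schwarz_second_coeff[OF assms] by (simp add: c_def)
  have c: "0 \<le> c" "0 \<le> 1 - c"
    using norm_ge_zero[of "taylor_coeff u 2"] c2 by (simp_all only: c_def) simp_all
  have "cmod (taylor_coeff u 2 + t * (taylor_coeff u 1)\<^sup>2) \<le> (1 - c) * 1 + c * cmod t"
    using c2 norm_triangle_ineq[of "taylor_coeff u 2" "t * (taylor_coeff u 1)\<^sup>2"]
    by (simp add: c_def norm_mult norm_power mult.commute)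
  also have "\<dots> \<le> (1 - c) * max 1 (cmod t) + c * max 1 (cmod t)"
    using c by (intro add_mono mult_left_mono) auto
  finally show ?thesis by (simp add: algebra_simps)
qed

section \<open>The \<open>g\<close>-derivative near the origin\<close>

text \<open>
  At any \<open>r > 0\<close> below both radii of convergence, the terms of one series are bounded and
  those of the other absolutely summable, so the termwise product converges at \<open>r\<^sup>2\<close>.
\<close>
lemma fps_conv_radius_Hadamard_pos:
  fixes F G :: "complex fps"
  assumes "fps_conv_radius F > 0" "fps_conv_radius G > 0"
  shows "fps_conv_radius (Abs_fps (\<lambda>n. fps_nth F n * fps_nth G n)) > 0"
proof -
  obtain r where r: "0 < ereal r" "ereal r < min (fps_conv_radius F) (fps_conv_radius G)"
    using ereal_dense2[of 0 "min (fps_conv_radius F) (fps_conv_radius G)"] assms by auto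
  have "summable (\<lambda>n. norm (fps_nth F n * of_real r ^ n))"
    "summable (\<lambda>n. fps_nth G n * of_real r ^ n)"
    using r unfolding fps_conv_radius_def
    by (auto intro!: abs_summable_in_conv_radius summable_in_conv_radius)
  then have sF: "summable (\<lambda>n. norm (fps_nth F n * of_real r ^ n))"
    and "(\<lambda>n. fps_nth G n * of_real r ^ n) \<longlonglongrightarrow> 0"
    by (auto intro: summable_LIMSEQ_zero)
  from this(2) have "eventually (\<lambda>n. dist (fps_nth G n * of_real r ^ n) 0 < 1) sequentially"
    by (rule tendstoD) simp
  then have "eventually (\<lambda>n. norm (fps_nth F n * fps_nth G n * of_real (r\<^sup>2) ^ n) \<le>
      norm (fps_nth F n * of_real r ^ n)) sequentially"
  proof eventually_elim
    case (elim n)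
    have "norm (fps_nth F n * fps_nth G n * of_real (r\<^sup>2) ^ n) =
        norm (fps_nth F n * of_real r ^ n) * norm (fps_nth G n * of_real r ^ n)"
      by (simp add: norm_mult norm_power power2_eq_square power_mult_distrib abs_mult)
    also have "\<dots> \<le> norm (fps_nth F n * of_real r ^ n)"
      using elim by (intro mult_right_le_one_le) auto
    finally show ?case .
  qed
  then have "summable (\<lambda>n. fps_nth F n * fps_nth G n * of_real (r\<^sup>2) ^ n)"
    using sF by (rule summable_comparison_test_ev)
  then have "conv_radius (\<lambda>n. fps_nth F n * fps_nth G n) \<ge> norm (of_real (r\<^sup>2) :: complex)"
    by (rule conv_radius_geI)
  moreover have "0 < ereal (norm (of_real (r\<^sup>2) :: complex))"
    using r(1) by simp
  ultimately show ?thesis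
    unfolding fps_conv_radius_def fps_nth_Abs_fps by (rule less_le_trans[rotated])
qed

lemma g_derivative_has_fps_expansion:
  assumes "f holomorphic_on ball 0 1" "g holomorphic_on ball 0 1"
  shows "g_derivative g f has_fps_expansion
    Abs_fps (\<lambda>n. g_number g (Suc n) * taylor_coeff f (Suc n))"
proof -
  \<comment> \<open>The full Hadamard product; the series in question is its shift by one.\<close>
  let ?H = "Abs_fps (\<lambda>n. taylor_coeff g n * taylor_coeff f n)"
  have "fps_conv_radius ?H > 0"
    using has_fps_expansion_unit_disc[OF assms(1)] has_fps_expansion_unit_disc[OF assms(2)]
    by (intro fps_conv_radius_Hadamard_pos) (auto simp: has_fps_expansion_def)
  moreover have "fps_shift 1 ?H = Abs_fps (\<lambda>n. g_number g (Suc n) * taylor_coeff f (Suc n))"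
    by (simp add: fps_eq_iff g_number_def)
  ultimately have "fps_conv_radius (Abs_fps (\<lambda>n. g_number g (Suc n) * taylor_coeff f (Suc n))) > 0"
    using fps_conv_radius_shift[of 1 ?H] by metis
  moreover have "eval_fps (Abs_fps (\<lambda>n. g_number g (Suc n) * taylor_coeff f (Suc n))) =
      g_derivative g f"
    by (rule ext) (simp add: eval_fps_def g_derivative_def)
  ultimately show ?thesis by (simp add: has_fps_expansion_def)
qed

text \<open>
  As \<open>f\<close> has a simple zero at the origin, the quotient has an isolated singularity there, and
  \<open>remove_sings\<close> changes it at no other nearby point.  At the origin both sides vanish.
\<close>
lemma g_quotient_mult_eq:
  assumes f: "f \<in> normalized_analytic" and g: "g \<in> normalized_analytic"
  defines "F \<equiv> remove_sings (\<lambda>z. z * g_derivative g f z / f z)"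
  shows "eventually (\<lambda>z. F z * f z = z * g_derivative g f z) (nhds 0)"
proof -
  have hol: "f holomorphic_on ball 0 1" "g holomorphic_on ball 0 1"
    and f0: "f 0 = 0" and f1: "deriv f 0 = 1"
    using f g by (auto simp: normalized_analytic_def)
  obtain h where h: "h holomorphic_on ball 0 1" "\<And>z. cmod z < 1 \<Longrightarrow> f z = z * h z" "h 0 = 1"
    using Schwarz3[OF hol(1) f0] f1 by metis
  have "isCont h 0"
    using holomorphic_on_imp_continuous_on[OF h(1)] by (simp add: continuous_on_eq_continuous_at)
  then have "eventually (\<lambda>z. h z \<noteq> 0) (at 0)"
    using h(3) by (auto simp: isCont_def intro!: tendsto_imp_eventually_ne)
  moreover have "eventually (\<lambda>z. z \<in> ball 0 1 - {0}) (at (0::complex))"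
    by (rule eventually_at_in_open) auto
  ultimately have nz: "eventually (\<lambda>z. f z \<noteq> 0) (at 0)"
    by eventually_elim (auto simp: h(2))
  have an: "g_derivative g f analytic_on {0}" "f analytic_on {0}"
    using g_derivative_has_fps_expansion[OF hol] has_fps_expansion_unit_disc[OF hol(1)]
    by (auto intro: has_fps_expansion_imp_analytic_0)
  have "isolated_singularity_at (\<lambda>z. z * g_derivative g f z / f z) 0"
    by (intro isolated_singularity_at_divide isolated_singularity_at_analytic
        not_essential_analytic analytic_intros an)
  then have "eventually (\<lambda>z. F z = z * g_derivative g f z / f z) (at 0)"
    unfolding F_def by (rule eventually_remove_sings_eq_at)
  with nz have "eventually (\<lambda>z. F z * f z = z * g_derivative g f z) (at 0)"
    by eventually_elim auto
  then show ?thesis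
    using f0 by (auto simp: eventually_nhds_conv_at)
qed

lemma fps_compose_nth_1_2:
  fixes F G :: "complex fps"
  assumes "fps_nth G 0 = 0"
  shows "fps_nth (F oo G) 1 = fps_nth F 1 * fps_nth G 1"
    and "fps_nth (F oo G) 2 = fps_nth F 1 * fps_nth G 2 + fps_nth F 2 * (fps_nth G 1)\<^sup>2"
  using assms
  by (simp_all add: fps_compose_nth numeral_2_eq_2 fps_mult_nth power2_eq_square)

theorem theorem2p10:
  fixes f g \<phi> :: "complex \<Rightarrow> complex" and a B :: "nat \<Rightarrow> complex" and \<mu> :: complex
  defines "a \<equiv> taylor_coeff f" and "B \<equiv> taylor_coeff \<phi>"
  assumes "g \<in> normalized_analytic"
    and "g_number g 2 \<noteq> 1" and "g_number g 3 \<noteq> 1"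
    and "positive_symmetric \<phi>"
    and "f \<in> g_starlike g \<phi>"
  shows "cmod (a 3 - \<mu> * (a 2)\<^sup>2) \<le>
    cmod (B 1 / (g_number g 3 - 1)) *
      max 1 (cmod (B 2 / B 1 + B 1 / (g_number g 2 - 1) *
        (1 - (g_number g 3 - 1) / (g_number g 2 - 1) * \<mu>)))"
proof -
  define F where "F = remove_sings (\<lambda>z. z * g_derivative g f z / f z)"
  have f: "f \<in> normalized_analytic" and sub: "F \<prec> \<phi>"
    using assms(7) by (auto simp: g_starlike_def F_def)
  have holf: "f holomorphic_on ball 0 1" and holg: "g holomorphic_on ball 0 1"
    using f assms(3) by (auto simp: normalized_analytic_def)
  from sub obtain u where holF: "F holomorphic_on ball 0 1"
    and hol\<phi>: "\<phi> holomorphic_on ball 0 1"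
    and u: "u holomorphic_on ball 0 1" "u 0 = 0" "\<And>z. cmod z < 1 \<Longrightarrow> cmod (u z) < 1"
    and Fu: "\<And>z. cmod z < 1 \<Longrightarrow> F z = \<phi> (u z)"
    unfolding subordinate_def by auto
  define P where "P = fps_expansion F 0"
  define c where "c = taylor_coeff u"
  have B0: "B 0 = 1" and B1: "B 1 \<noteq> 0"
    using assms(6) unfolding B_def taylor_coeff_1 positive_symmetric_def
    by (auto simp: fps_expansion_def)
  have c0: "c 0 = 0" using u(2) by (simp add: c_def fps_expansion_def)

  have "(\<phi> \<circ> u) has_fps_expansion (fps_expansion \<phi> 0 oo fps_expansion u 0)"
    using c0 by (intro has_fps_expansion_compose has_fps_expansion_unit_disc hol\<phi> u)
      (simp add: c_def)
  then have P: "P = fps_expansion \<phi> 0 oo fps_expansion u 0"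
    unfolding P_def by (intro fps_expansion_eq_unit_disc) (simp_all add: Fu)
  have P0: "fps_nth P 0 = 1" using B0 by (simp add: P B_def)
  have P1: "fps_nth P 1 = B 1 * c 1"
    and P2: "fps_nth P 2 = B 1 * c 2 + B 2 * (c 1)\<^sup>2"
    using c0 fps_compose_nth_1_2[of "fps_expansion u 0" "fps_expansion \<phi> 0"]
    unfolding P B_def c_def by auto

  let ?H = "Abs_fps (\<lambda>n. g_number g (Suc n) * taylor_coeff f (Suc n))"
  have "(\<lambda>z. z * g_derivative g f z) has_fps_expansion fps_X * ?H"
    by (intro fps_expansion_intros g_derivative_has_fps_expansion holf holg)
  moreover have "(\<lambda>z. F z * f z) has_fps_expansion P * fps_expansion f 0"
    unfolding P_def by (intro fps_expansion_intros has_fps_expansion_unit_disc holf holF)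
  then have "(\<lambda>z. z * g_derivative g f z) has_fps_expansion P * fps_expansion f 0"
    using has_fps_expansion_cong[OF g_quotient_mult_eq[OF f assms(3)] refl]
    unfolding F_def by blast
  ultimately have eq: "P * fps_expansion f 0 = fps_X * ?H"
    using fps_expansion_unique_complex by blast
  have a0: "a 0 = 0" "a 1 = 1"
    using normalized_analytic_taylor_coeff[OF f] by (auto simp: a_def)
  have "fps_nth (P * fps_expansion f 0) 2 = a 2 + fps_nth P 1"
    "fps_nth (P * fps_expansion f 0) 3 = a 3 + fps_nth P 1 * a 2 + fps_nth P 2"
    using a0 P0 by (simp_all add: fps_mult_nth numeral_2_eq_2 numeral_3_eq_3 a_def)
  moreover have "fps_nth (fps_X * ?H) 2 = g_number g 2 * a 2"
    "fps_nth (fps_X * ?H) 3 = g_number g 3 * a 3"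
    by (simp_all add: a_def numeral_2_eq_2 numeral_3_eq_3)
  ultimately have e: "a 2 * (g_number g 2 - 1) = B 1 * c 1"
    "a 3 * (g_number g 3 - 1) = B 1 * c 2 + B 2 * (c 1)\<^sup>2 + B 1 * c 1 * a 2"
    unfolding eq P1 P2 by (auto simp: algebra_simps)
  \<comment> \<open>What remains is to solve these two equations for \<open>a 2\<close> and \<open>a 3\<close>.\<close>
  define p q where "p = g_number g 2 - 1" and "q = g_number g 3 - 1"
  have pq: "p \<noteq> 0" "q \<noteq> 0" using assms(4,5) by (auto simp: p_def q_def)
  have a2: "a 2 = B 1 * c 1 / p" using e(1) pq by (simp add: p_def field_simps)
  have a3: "a 3 = (B 1 * c 2 + B 2 * (c 1)\<^sup>2 + B 1 * c 1 * a 2) / q"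
    using e(2) pq by (simp add: q_def field_simps)
  define t where "t = B 2 / B 1 + B 1 / p * (1 - q / p * \<mu>)"
  have "a 3 - \<mu> * (a 2)\<^sup>2 = B 1 / q * (c 2 + t * (c 1)\<^sup>2)"
    unfolding a3 a2 t_def using pq B1 by (simp add: field_simps power2_eq_square)
  then have "cmod (a 3 - \<mu> * (a 2)\<^sup>2) = cmod (B 1 / q) * cmod (c 2 + t * (c 1)\<^sup>2)"
    by (simp only: norm_mult)
  also have "\<dots> \<le> cmod (B 1 / q) * max 1 (cmod t)"
    unfolding c_def by (intro mult_left_mono Schwarz_Fekete_Szego u) auto
  finally show ?thesis by (simp add: t_def p_def q_def)
qed

end
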